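(* For $a\in(0,1)$ let $T_a:[0,1]\to[0,1]$ be defined by $T_a(x)=\frac xa$ if $x<a$ and $T_a(x)=\frac{x-a}{1-a}$ otherwise, and let $\mu_a$ be its unique absolutely continuous invariant probability measure (which is Lebesgue measure on $[0,1]$). If $X:(0,1)\to(0,1)$ is a $C^1$ map such that $X'(a)\le0$ for all $a$, then $X(a)$ is typical for $\mu_a$ for a.e. parameter $a\in(0,1)$.
   Context: A point $x$ is typical for $\mu_a$ if $\frac1n\sum_{i=0}^{n-1}\delta_{T_a^i(x)}\to\mu_a$ in the weak-$*$ topology as $n\to\infty$. *)

theory Defs
  imports "HOL-Probability.Probability"
begin

definition T :: "real \<Rightarrow> real \<Rightarrow> real" where
  "T a x = (if x < a then x / a else (x - a) / (1 - a))"

abbreviation borel01 :: "real measure" where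
  "borel01 \<equiv> restrict_space borel {0..1}"

abbreviation lebesgue01 :: "real measure" where
  "lebesgue01 \<equiv> restrict_space lborel {0..1}"

text \<open>Fixing the sigma-algebra to be the Borel sets of the unit interval makes
  uniqueness meaningful as equality of measures.\<close>

definition acip :: "(real \<Rightarrow> real) \<Rightarrow> real measure \<Rightarrow> bool" where
  "acip S M \<longleftrightarrow> sets M = sets borel01 \<and> prob_space M \<and>
     absolutely_continuous lebesgue01 M \<and>
     S \<in> measurable M M \<and> distr M M S = M"

definition \<mu> :: "real \<Rightarrow> real measure" where
  "\<mu> a = (THE M. acip (T a) M)"

definition empirical :: "(real \<Rightarrow> real) \<Rightarrow> real \<Rightarrow> nat \<Rightarrow> real measure" where
  "empirical S x n = measure_of (space borel01) (sets borel01)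
     (\<lambda>A. (\<Sum>i<n. emeasure (return borel01 ((S ^^ i) x)) A) / of_nat n)"

text \<open>Convergence in the dual of the space of continuous functions on the unit interval.\<close>

definition weak_star_conv :: "(nat \<Rightarrow> real measure) \<Rightarrow> real measure \<Rightarrow> bool" where
  "weak_star_conv N M \<longleftrightarrow>
     (\<forall>f :: real \<Rightarrow> real. continuous_on {0..1} f \<longrightarrow>
        (\<lambda>n. \<integral>y. f y \<partial>N n) \<longlonglongrightarrow> (\<integral>y. f y \<partial>M))"

definition typical :: "(real \<Rightarrow> real) \<Rightarrow> real measure \<Rightarrow> real \<Rightarrow> bool" where
  "typical S M x \<longleftrightarrow> weak_star_conv (empirical S x) M"

lemma space_empirical [simp]: "space (empirical S x n) = {0..1}"
  and sets_empirical [simp, measurable_cong]: "sets (empirical S x n) = sets borel01"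
  using sets.space_closed[of borel01] sets.sigma_sets_eq[of borel01]
  by (auto simp: empirical_def space_restrict_space)

text \<open>The set function in the definition of the empirical measure is countably additive, so the
  empirical measure really takes these values.\<close>

lemma emeasure_empirical:
  assumes "A \<in> sets borel01"
  shows "emeasure (empirical S x n) A =
    (\<Sum>i<n. emeasure (return borel01 ((S ^^ i) x)) A) / of_nat n"
proof (rule emeasure_measure_of[OF empirical_def])
  let ?m = "\<lambda>A. (\<Sum>i<n. emeasure (return borel01 ((S ^^ i) x)) A) / of_nat n"
  show "sets borel01 \<subseteq> Pow (space borel01)"
    by (rule sets.space_closed)
  show "A \<in> sets (empirical S x n)"
    using assms by simp
  show "positive (sets (empirical S x n)) ?m"
    by (simp add: positive_def)
  show "countably_additive (sets (empirical S x n)) ?m"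
  proof (rule countably_additiveI)
    fix F :: "nat \<Rightarrow> real set"
    assume F: "range F \<subseteq> sets (empirical S x n)" "disjoint_family F"
    have "(\<Sum>k. ?m (F k)) = (\<Sum>k. \<Sum>i<n. emeasure (return borel01 ((S ^^ i) x)) (F k)) / of_nat n"
      by (rule ennreal_suminf_divide)
    also have "(\<Sum>k. \<Sum>i<n. emeasure (return borel01 ((S ^^ i) x)) (F k)) =
        (\<Sum>i<n. \<Sum>k. emeasure (return borel01 ((S ^^ i) x)) (F k))"
      by (rule suminf_sum) simp
    also have "\<dots> = (\<Sum>i<n. emeasure (return borel01 ((S ^^ i) x)) (\<Union>k. F k))"
      using F by (intro sum.cong refl suminf_emeasure) auto
    finally show "(\<Sum>k. ?m (F k)) = ?m (\<Union>k. F k)" .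
  qed
qed

end

theory Submission
  imports Defs
begin

text \<open>Code orbits by the digits \<open>x < a\<close>; under Lebesgue measure these are independent Bernoulli
  digits. If \<open>s < t\<close> and the points \<open>X t \<le> X s\<close> have the same first \<open>n\<close> digits \<open>w\<close> under \<open>T s\<close> and
  \<open>T t\<close>, then the two orbits drift apart by a factor of at least the slope of \<open>T s\<close> in every step, and
  since they stay in the unit interval \<open>t - s\<close> is at most a constant times the probability of \<open>w\<close> for
  the parameter \<open>s\<close>. Hence the set of parameters with an untypical word of length \<open>n\<close> near a fixed
  parameter \<open>p\<close> has measure at most \<open>exp (\<epsilon> n)\<close> times the exponentially small probability of such
  words for \<open>p\<close>. Borel--Cantelli gives that, for almost every parameter, the digit preceding an
  occurrence of a word \<open>u\<close> is asymptotically unbiased for every \<open>u\<close>; by induction all words have the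
  right frequency, which is typicality.

  The same argument with the parameter fixed and the point varying shows that Lebesgue almost every
  point is typical. Dominated convergence then forces every absolutely continuous invariant probability
  measure to agree with Lebesgue measure on continuous functions.\<close>

section \<open>Words and inverse branches\<close>

text \<open>Digits are coded by \<^term>\<open>True\<close> for the left branch (\<open>x < a\<close>, Lebesgue measure \<open>a\<close>)
  and \<^term>\<open>False\<close> for the right one.\<close>

primrec word_prob :: "real \<Rightarrow> bool list \<Rightarrow> real" where
  "word_prob a [] = 1"
| "word_prob a (d # w) = (if d then a else 1 - a) * word_prob a w"

primrec branch :: "real \<Rightarrow> bool list \<Rightarrow> real \<Rightarrow> real" where
  "branch a [] y = y"
| "branch a (d # w) y = (if d then a * branch a w y else a + (1 - a) * branch a w y)"

primrec itinerary :: "real \<Rightarrow> real \<Rightarrow> nat \<Rightarrow> bool list" where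
  "itinerary a x 0 = []"
| "itinerary a x (Suc n) = (x < a) # itinerary a (T a x) n"

text \<open>Positions followed by fewer than \<^term>\<open>length u\<close> digits are ignored, so that a word of length
  \<^term>\<open>n + length u\<close> contributes exactly \<open>n\<close> terms.\<close>

primrec word_dev :: "real \<Rightarrow> bool list \<Rightarrow> bool list \<Rightarrow> real" where
  "word_dev p u [] = 0"
| "word_dev p u (d # w) =
     (if length w < length u then 0 else (of_bool d - p) * of_bool (take (length u) w = u)) + word_dev p u w"

definition words :: "nat \<Rightarrow> bool list set" where
  "words n = {w. length w = n}"

lemma finite_words [simp, intro]: "finite (words n)"
  using finite_lists_length_eq[of "UNIV :: bool set" n] by (simp add: words_def)

lemma words_0 [simp]: "words 0 = {[]}"
  by (auto simp: words_def)

lemma words_Suc: "words (Suc n) = (#) True ` words n \<union> (#) False ` words n"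
proof -
  have "w \<in> (#) True ` words n \<union> (#) False ` words n" if "length w = Suc n" for w
    using that by (cases w; cases "hd w") (auto simp: words_def)
  then show ?thesis by (auto simp: words_def)
qed

lemma sum_words_Suc:
  "(\<Sum>w\<in>words (Suc n). F w) = (\<Sum>w\<in>words n. F (True # w) + F (False # w :: bool list) :: real)"
  unfolding words_Suc
  by (subst sum.union_disjoint) (auto simp: sum.reindex inj_on_def sum.distrib)

lemma length_itinerary [simp]: "length (itinerary a x n) = n"
  by (induction n arbitrary: x) auto

lemma take_itinerary: "m \<le> n \<Longrightarrow> take m (itinerary a x n) = itinerary a x m"
proof (induction m arbitrary: x n)
  case (Suc m)
  then show ?case by (cases n) auto
qed simp

lemma T_in_unit: "0 < a \<Longrightarrow> a < 1 \<Longrightarrow> x \<in> {0..1} \<Longrightarrow> T a x \<in> {0..1}"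
  by (auto simp: T_def field_simps)

lemma funpow_T_in_unit:
  assumes "0 < a" "a < 1" "x \<in> {0..1}" shows "(T a ^^ n) x \<in> {0..1}"
  by (induction n) (use assms T_in_unit in \<open>auto simp del: atLeastAtMost_iff\<close>)

lemma word_prob_pos: "0 < a \<Longrightarrow> a < 1 \<Longrightarrow> 0 < word_prob a w"
  by (induction w) auto

text \<open>Each digit costs at most a factor \<open>K\<close>. With
  \<open>K = exp (e\<^sup>2)\<close> this passes from a parameter to a nearby reference
  parameter.\<close>

lemma word_prob_mono:
  assumes "0 < a" "a < 1" "0 < p" "p < 1" "a \<le> K * p" "1 - a \<le> K * (1 - p)"
  shows "word_prob a w \<le> K ^ length w * word_prob p w"
proof (induction w)
  case (Cons d w)
  have "word_prob a (d # w) \<le> (K * (if d then p else 1 - p)) * (K ^ length w * word_prob p w)"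
    unfolding word_prob.simps
    by (rule mult_mono[OF _ Cons]) (use assms word_prob_pos[of a w] in \<open>auto intro: order.trans[of 0 a] order.trans[of 0 "1-a"]\<close>)
  then show ?case by (simp add: mult_ac)
qed simp

lemma word_prob_le_power:
  assumes "0 < a" "a < 1"
  shows "word_prob a w \<le> max a (1 - a) ^ length w"
proof (induction w)
  case (Cons d w)
  have "word_prob a (d # w) \<le> max a (1 - a) * max a (1 - a) ^ length w"
    unfolding word_prob.simps by (rule mult_mono[OF _ Cons]) (use assms word_prob_pos[of a w] in auto)
  then show ?case by simp
qed simp

text \<open>\<open>branch a w\<close> is affine with slope \<open>word_prob a w\<close>, so points
  sharing the itinerary \<open>w\<close> are at most that far apart.\<close>

lemma branch_diff: "branch a w y - branch a w z = word_prob a w * (y - z)"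
  by (induction w) (auto simp: right_diff_distrib mult.assoc simp flip: right_diff_distrib)

lemma branch_in_unit:
  assumes "0 < a" "a < 1" "y \<in> {0..1}" shows "branch a w y \<in> {0..1}"
proof (induction w)
  case (Cons d w)
  then have "a * branch a w y \<le> 1" "(1 - a) * branch a w y \<le> 1 - a"
    using assms by (auto intro!: mult_le_one mult_left_le)
  moreover from this have "a + (1 - a) * branch a w y \<le> 1" by linarith
  ultimately have "a * branch a w y \<le> 1" "a + (1 - a) * branch a w y \<le> 1" by blast+
  then show ?case using Cons assms by auto
qed (use assms in auto)

lemma branch_itinerary: "0 < a \<Longrightarrow> a < 1 \<Longrightarrow> branch a (itinerary a x n) ((T a ^^ n) x) = x"
proof (induction n arbitrary: x)
  case (Suc n)
  then show ?case by (auto simp: funpow_Suc_right T_def simp del: funpow.simps)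
qed simp

lemma word_dev_eq_0: "length w \<le> length u \<Longrightarrow> word_dev p u w = 0"
  by (induction w) auto

text \<open>Position \<open>n - 1\<close> looks ahead to the digit with index
  \<open>n - 1 + length u\<close>, the last one in the itinerary.\<close>

lemma word_dev_itinerary:
  "word_dev p u (itinerary a x (n + length u)) =
     (\<Sum>i<n. (of_bool ((T a ^^ i) x < a) - p) * of_bool (itinerary a ((T a ^^ Suc i) x) (length u) = u))"
proof (induction n arbitrary: x)
  case 0
  then show ?case by (simp add: word_dev_eq_0)
next
  case (Suc n)
  show ?case
    by (simp add: Suc sum.lessThan_Suc_shift take_itinerary funpow_Suc_right del: funpow.simps sum.lessThan_Suc)
qed

section \<open>Exponential moments and large deviations of digit sums\<close>

text \<open>Hoeffding's lemma for a centred Bernoulli variable. Negative \<open>h\<close> reduces to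
  positive \<open>h\<close> by exchanging \<open>p\<close> and \<open>1 - p\<close>.\<close>

lemma bernoulli_mgf:
  fixes p h :: real
  assumes "0 \<le> p" "p \<le> 1"
  shows "p * exp (h * (1 - p)) + (1 - p) * exp (- (h * p)) \<le> exp (h\<^sup>2 / 8)"
proof -
  have *: "p * exp (h * (1 - p)) + (1 - p) * exp (- (h * p)) \<le> exp (h\<^sup>2 / 8)"
    if "0 \<le> p" "p \<le> 1" "0 \<le> h" for p h :: real
  proof -
    have pos: "1 + p * (exp h - 1) > 0"
      using that by (intro add_pos_nonneg mult_nonneg_nonneg) auto
    have "p * exp (h * (1 - p)) + (1 - p) * exp (- (h * p)) = exp (- h * p) * (1 + p * (exp h - 1))"
      by (simp add: algebra_simps flip: exp_add)
    also have "\<dots> = exp (- h * p + ln (1 + p * (exp h - 1)))"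
      unfolding exp_add using pos by simp
    also have "\<dots> \<le> exp (h\<^sup>2 / 8)"
      using Hoeffdings_lemma_aux[of h p] that by simp
    finally show ?thesis .
  qed
  show ?thesis
  proof (cases "h \<ge> 0")
    case False
    then show ?thesis using *[of "1 - p" "- h"] assms by (simp add: algebra_simps)
  qed (use * assms in auto)
qed

text \<open>Reading a word from the right, the first digit is independent of the rest, so each digit costs
  at most one factor of the Bernoulli moment generating function.\<close>

lemma word_dev_mgf:
  assumes "0 < p" "p < 1"
  shows "(\<Sum>w\<in>words n. word_prob p w * exp (h * word_dev p u w)) \<le> exp (h\<^sup>2 / 8) ^ n"
proof -
  have gen: "p * b * (x * z) + (1 - p) * b * (y * z) = (p * x + (1 - p) * y) * (b * z)" for b x y z :: real
    by (simp add: algebra_simps)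
  show ?thesis
  proof (induction n)
  case (Suc n)
  have "(\<Sum>w\<in>words (Suc n). word_prob p w * exp (h * word_dev p u w))
      \<le> (\<Sum>w\<in>words n. exp (h\<^sup>2 / 8) * (word_prob p w * exp (h * word_dev p u w)))"
    unfolding sum_words_Suc
  proof (rule sum_mono)
    fix w assume "w \<in> words n"
    \<comment> \<open>\<open>c\<close> depends on the tail \<open>w\<close> only, so the prepended
      digit remains free: it is averaged when \<open>c = 1\<close> and has no effect when
      \<open>c = 0\<close>.\<close>
    define c :: real where "c = (if length w < length u then 0 else of_bool (take (length u) w = u))"
    have c: "c = 0 \<or> c = 1" by (auto simp: c_def)
    have d: "word_dev p u (b # w) = (of_bool b - p) * c + word_dev p u w" for b
      by (simp add: c_def)
    have E: "exp (h * word_dev p u (True # w)) = exp (h * ((1 - p) * c)) * exp (h * word_dev p u w)"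
      "exp (h * word_dev p u (False # w)) = exp (- (h * p * c)) * exp (h * word_dev p u w)"
      unfolding d exp_add[symmetric] by (simp_all add: algebra_simps)
    have "p * exp (h * ((1 - p) * c)) + (1 - p) * exp (- (h * p * c)) \<le> exp (h\<^sup>2 / 8)"
      using c bernoulli_mgf[of p h] assms by auto
    then have "(p * exp (h * ((1 - p) * c)) + (1 - p) * exp (- (h * p * c))) * (word_prob p w * exp (h * word_dev p u w))
      \<le> exp (h\<^sup>2 / 8) * (word_prob p w * exp (h * word_dev p u w))"
      using assms word_prob_pos[of p w] by (intro mult_right_mono) auto
    then show "word_prob p (True # w) * exp (h * word_dev p u (True # w)) + word_prob p (False # w) * exp (h * word_dev p u (False # w))
      \<le> exp (h\<^sup>2 / 8) * (word_prob p w * exp (h * word_dev p u w))"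
      unfolding E word_prob.simps if_True if_False gen .
  qed
  also have "\<dots> \<le> exp (h\<^sup>2 / 8) * exp (h\<^sup>2 / 8) ^ n"
    unfolding sum_distrib_left[symmetric] by (intro mult_left_mono Suc) auto
  finally show ?case by simp
  qed simp
qed

text \<open>Chernoff's bound for both tails with exponent \<open>4 * e\<close>, the minimiser of
  \<open>h\<^sup>2 / 8 - h * e\<close>. The moment bound pays for \<open>n + length u\<close> digits
  but the threshold grows with \<open>n\<close> only, whence the factor
  \<open>exp (2 * e\<^sup>2 * length u)\<close>.\<close>

lemma word_dev_large_deviation:
  fixes e :: real
  assumes "0 < p" "p < 1" "0 < e"
  shows "(\<Sum>w | w \<in> words (n + length u) \<and> e * n < \<bar>word_dev p u w\<bar>. word_prob p w)
    \<le> 2 * exp (2 * e\<^sup>2 * length u) * exp (- 2 * e\<^sup>2 * n)"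
proof -
  let ?N = "n + length u"
  have one: "(\<Sum>w\<in>words ?N. word_prob p w * (exp (4 * e * (s * word_dev p u w)) * exp (- 4 * e\<^sup>2 * n)))
    \<le> exp (2 * e\<^sup>2 * length u) * exp (- 2 * e\<^sup>2 * n)" if "s\<^sup>2 = 1" for s :: real
  proof -
    have "(\<Sum>w\<in>words ?N. word_prob p w * (exp (4 * e * (s * word_dev p u w)) * exp (- 4 * e\<^sup>2 * n)))
      = (\<Sum>w\<in>words ?N. word_prob p w * exp (4 * e * s * word_dev p u w)) * exp (- 4 * e\<^sup>2 * n)"
      by (simp add: sum_distrib_right mult.assoc)
    also have "\<dots> \<le> exp ((4 * e * s)\<^sup>2 / 8) ^ ?N * exp (- 4 * e\<^sup>2 * n)"
      by (intro mult_right_mono word_dev_mgf assms) auto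
    also have "\<dots> = exp (2 * e\<^sup>2 * length u) * exp (- 2 * e\<^sup>2 * n)"
      using that by (simp add: power_mult_distrib exp_of_nat_mult[symmetric] exp_add[symmetric] algebra_simps)
    finally show ?thesis .
  qed
  have "(\<Sum>w | w \<in> words ?N \<and> e * n < \<bar>word_dev p u w\<bar>. word_prob p w)
    \<le> (\<Sum>w | w \<in> words ?N \<and> e * n < \<bar>word_dev p u w\<bar>. word_prob p w * (exp (4 * e * (1 * word_dev p u w)) * exp (- 4 * e\<^sup>2 * n))
        + word_prob p w * (exp (4 * e * (- 1 * word_dev p u w)) * exp (- 4 * e\<^sup>2 * n)))"
  proof (rule sum_mono)
    fix w assume "w \<in> {w. w \<in> words ?N \<and> e * n < \<bar>word_dev p u w\<bar>}"
    then have "e * n \<le> \<bar>word_dev p u w\<bar>" by simp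
    then have "e * (e * n) \<le> e * \<bar>word_dev p u w\<bar>" using assms by (intro mult_left_mono) auto
    then have "0 \<le> 4 * e * word_dev p u w + - 4 * e\<^sup>2 * n \<or> 0 \<le> 4 * e * (- word_dev p u w) + - 4 * e\<^sup>2 * n"
      by (cases "word_dev p u w \<ge> 0") (auto simp: power2_eq_square)
    then have "1 \<le> exp (4 * e * word_dev p u w + - 4 * e\<^sup>2 * n) \<or> 1 \<le> exp (4 * e * (- word_dev p u w) + - 4 * e\<^sup>2 * n)"
      by (metis one_le_exp_iff)
    moreover have "exp (4 * e * word_dev p u w + - 4 * e\<^sup>2 * n) > 0" "exp (4 * e * (- word_dev p u w) + - 4 * e\<^sup>2 * n) > 0"
      by (rule exp_gt_zero)+
    ultimately have "1 \<le> exp (4 * e * word_dev p u w + - 4 * e\<^sup>2 * n) + exp (4 * e * (- word_dev p u w) + - 4 * e\<^sup>2 * n)"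
      by linarith
    then have "word_prob p w * 1 \<le> word_prob p w * (exp (4 * e * word_dev p u w + - 4 * e\<^sup>2 * n) + exp (4 * e * (- word_dev p u w) + - 4 * e\<^sup>2 * n))"
      using word_prob_pos[of p w] assms by (intro mult_left_mono) auto
    then show "word_prob p w \<le> word_prob p w * (exp (4 * e * (1 * word_dev p u w)) * exp (- 4 * e\<^sup>2 * n))
        + word_prob p w * (exp (4 * e * (- 1 * word_dev p u w)) * exp (- 4 * e\<^sup>2 * n))"
      unfolding exp_add by (simp add: distrib_left)
  qed
  also have "\<dots> \<le> (\<Sum>w\<in>words ?N. word_prob p w * (exp (4 * e * (1 * word_dev p u w)) * exp (- 4 * e\<^sup>2 * n))
        + word_prob p w * (exp (4 * e * (- 1 * word_dev p u w)) * exp (- 4 * e\<^sup>2 * n)))"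
    using assms by (intro sum_mono2) (auto intro!: add_nonneg_nonneg mult_nonneg_nonneg less_imp_le[OF word_prob_pos])
  also have "\<dots> \<le> exp (2 * e\<^sup>2 * length u) * exp (- 2 * e\<^sup>2 * n) + exp (2 * e\<^sup>2 * length u) * exp (- 2 * e\<^sup>2 * n)"
    unfolding sum.distrib by (intro add_mono one) auto
  finally show ?thesis by simp
qed

section \<open>Almost sure convergence of digit deviations\<close>

text \<open>The separation hypothesis covers the parameters with a given itinerary by an interval whose
  length is comparable to the probability of that word. Replacing \<^term>\<open>A t\<close> by the reference
  parameter \<open>p\<close> costs a factor \<^term>\<open>exp (e\<^sup>2) ^ n\<close>, which the Chernoff bound
  \<^term>\<open>exp (- 2 * e\<^sup>2 * n)\<close> absorbs.\<close>

lemma AE_eventually_word_dev_le: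
  fixes e C p :: real and A X :: "real \<Rightarrow> real" and V :: "real set"
  assumes p: "0 < p" "p < 1" and e: "0 < e" and C: "0 \<le> C"
    and A: "\<And>t. t \<in> V \<Longrightarrow> 0 < A t \<and> A t < 1 \<and> A t \<le> exp (e\<^sup>2) * p \<and> 1 - A t \<le> exp (e\<^sup>2) * (1 - p)"
    and sep: "\<And>s t n. s \<in> V \<Longrightarrow> t \<in> V \<Longrightarrow> s < t \<Longrightarrow> itinerary (A s) (X s) n = itinerary (A t) (X t) n
      \<Longrightarrow> t - s \<le> C * word_prob (A s) (itinerary (A s) (X s) n)"
  shows "AE t in lborel. t \<in> V \<longrightarrow>
    (\<forall>\<^sub>F n in sequentially. \<bar>word_dev p u (itinerary (A t) (X t) (n + length u))\<bar> \<le> e * n)"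
proof -
  let ?m = "length u"
  define R where "R n w = C * (exp (e\<^sup>2) ^ (n + ?m) * word_prob p w)" for n w
  define J where "J n w = {t \<in> V. itinerary (A t) (X t) (n + ?m) = w}" for n w
  \<comment> \<open>Any parameter with itinerary \<open>w\<close> serves as centre. If there is
    none, the interval is arbitrary and merely enlarges the cover.\<close>
  define s where "s n w = (SOME t. t \<in> J n w)" for n w
  define bad where "bad n = {w. w \<in> words (n + ?m) \<and> e * n < \<bar>word_dev p u w\<bar>}" for n
  \<comment> \<open>\<open>A\<close> and \<open>X\<close> are arbitrary functions here, so the set
    of bad parameters may fail to be measurable; this finite union of intervals covers it and is
    Borel.\<close>
  define B where "B n = (\<Union>w\<in>bad n. {s n w - R n w .. s n w + R n w})" for n
  have R0: "0 \<le> R n w" for n w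
    unfolding R_def using C word_prob_pos[OF p] by (intro mult_nonneg_nonneg) (auto intro: less_imp_le)
  have fin: "finite (bad n)" for n
    unfolding bad_def by simp
  have near: "t - r \<le> R n w" if "r \<in> J n w" "t \<in> J n w" for r t n w
  proof (cases "r < t")
    case True
    have w: "w = itinerary (A r) (X r) (n + ?m)" "length w = n + ?m"
      using that by (auto simp: J_def)
    have "t - r \<le> C * word_prob (A r) w"
      using that True sep[of r t "n + ?m"] by (auto simp: J_def)
    also have "\<dots> \<le> C * (exp (e\<^sup>2) ^ (n + ?m) * word_prob p w)"
      using A[of r] that(1) p w(2) C word_prob_mono[of "A r" p "exp (e\<^sup>2)" w]
      by (intro mult_left_mono) (auto simp: J_def)
    finally show ?thesis by (simp add: R_def)
  qed (use R0[of n w] in linarith)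
  have cover: "t \<in> B n" if "t \<in> V" "e * n < \<bar>word_dev p u (itinerary (A t) (X t) (n + ?m))\<bar>" for t n
  proof -
    define w where "w = itinerary (A t) (X t) (n + ?m)"
    have t: "t \<in> J n w" using that by (simp add: J_def w_def)
    then have s: "s n w \<in> J n w" unfolding s_def by (rule someI)
    have "w \<in> bad n" using that by (simp add: bad_def w_def words_def)
    moreover have "t \<in> {s n w - R n w .. s n w + R n w}"
      using near[OF s t] near[OF t s] by auto
    ultimately show ?thesis unfolding B_def by blast
  qed
  have meas: "B n \<in> sets lborel" for n
    unfolding B_def using fin by (intro sets.finite_UN) auto
  have em: "emeasure lborel (B n) \<le> ennreal (4 * C * exp (3 * e\<^sup>2 * ?m) * exp (- e\<^sup>2) ^ n)" for n
  proof -
    have "emeasure lborel (B n) \<le> (\<Sum>w\<in>bad n. emeasure lborel {s n w - R n w .. s n w + R n w})"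
      unfolding B_def by (rule emeasure_subadditive_finite) (use fin in auto)
    also have "\<dots> = (\<Sum>w\<in>bad n. ennreal (2 * R n w))"
      using R0 by (intro sum.cong refl) (simp add: emeasure_lborel_Icc)
    also have "\<dots> = ennreal (\<Sum>w\<in>bad n. 2 * R n w)"
      using R0 by (intro sum_ennreal) simp
    also have "(\<Sum>w\<in>bad n. 2 * R n w) = 2 * C * exp (e\<^sup>2) ^ (n + ?m) * (\<Sum>w\<in>bad n. word_prob p w)"
      unfolding R_def sum_distrib_left by (intro sum.cong refl) simp
    also have "\<dots> \<le> 2 * C * exp (e\<^sup>2) ^ (n + ?m) * (2 * exp (2 * e\<^sup>2 * ?m) * exp (- 2 * e\<^sup>2 * n))"
      unfolding bad_def using C by (intro mult_left_mono word_dev_large_deviation p e) auto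
    also have "\<dots> = 4 * C * (exp (e\<^sup>2 * n + e\<^sup>2 * ?m) * exp (2 * e\<^sup>2 * ?m) * exp (- 2 * e\<^sup>2 * n))"
      by (simp add: exp_of_nat_mult[symmetric] algebra_simps)
    also have "\<dots> = 4 * C * exp (3 * e\<^sup>2 * ?m) * exp (- e\<^sup>2) ^ n"
      by (simp add: exp_of_nat_mult[symmetric] exp_add[symmetric] algebra_simps)
    finally show ?thesis using ennreal_leI by auto
  qed
  have "AE t in lborel. \<forall>\<^sub>F n in sequentially. t \<in> space lborel - B n"
  proof (rule borel_cantelli_AE1[OF meas])
    show "emeasure lborel (B n) < \<infinity>" for n
      by (rule le_less_trans[OF em]) simp
    have m: "measure lborel (B n) \<le> 4 * C * exp (3 * e\<^sup>2 * ?m) * exp (- e\<^sup>2) ^ n" for n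
      unfolding measure_def by (rule enn2real_leI[OF _ em]) (use C in auto)
    have "norm (exp (- e\<^sup>2)) < 1" using e by simp
    then have "summable (\<lambda>n. 4 * C * exp (3 * e\<^sup>2 * ?m) * exp (- e\<^sup>2) ^ n)"
      by (intro summable_mult summable_geometric)
    then show "summable (\<lambda>n. measure lborel (B n))"
      by (rule summable_comparison_test'[of _ 0]) (use m in simp)
  qed
  then show ?thesis
  proof eventually_elim
    case (elim t)
    show ?case
    proof
      assume "t \<in> V"
      show "\<forall>\<^sub>F n in sequentially. \<bar>word_dev p u (itinerary (A t) (X t) (n + ?m))\<bar> \<le> e * n"
        using elim by eventually_elim (use cover[OF \<open>t \<in> V\<close>] in force)
    qed
  qed
qed

text \<open>The counterpart of \<open>word_dev\<close> along an orbit, centred at the true parameter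
  \<open>a\<close> instead of a reference parameter.\<close>

definition digit_dev :: "real \<Rightarrow> real \<Rightarrow> bool list \<Rightarrow> nat \<Rightarrow> real" where
  "digit_dev a x u n =
    (\<Sum>i<n. (of_bool ((T a ^^ i) x < a) - a) * of_bool (itinerary a ((T a ^^ Suc i) x) (length u) = u))"

lemma digit_dev_word_dev_diff: "\<bar>digit_dev a x u n - word_dev p u (itinerary a x (n + length u))\<bar> \<le> \<bar>a - p\<bar> * n"
proof -
  have "\<bar>digit_dev a x u n - word_dev p u (itinerary a x (n + length u))\<bar>
    = \<bar>\<Sum>i<n. (p - a) * of_bool (itinerary a ((T a ^^ Suc i) x) (length u) = u)\<bar>"
    unfolding digit_dev_def word_dev_itinerary sum_subtractf[symmetric]
    by (intro arg_cong[of _ _ abs] sum.cong) (auto simp: algebra_simps)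
  also have "\<dots> \<le> (\<Sum>i<n. \<bar>a - p\<bar>)"
    by (rule sum_abs[THEN order.trans], rule sum_mono) auto
  finally show ?thesis by (simp add: mult.commute)
qed

text \<open>The exceptional set need not be Borel, so the statement passes through the
  completion.\<close>

lemma AE_lborel_imp_negligible:
  assumes "AE t in lborel. t \<in> V \<longrightarrow> P t" shows "negligible {t \<in> V. \<not> P t}"
proof -
  have "AE t in lebesgue. t \<in> V \<longrightarrow> P t" using assms by (rule AE_completion)
  then obtain N where N: "N \<in> null_sets lebesgue" "\<And>t. t \<in> space lebesgue - N \<Longrightarrow> t \<in> V \<longrightarrow> P t"
    by (rule AE_E3) blast
  show ?thesis
    by (rule negligible_subset[of N]) (use N in \<open>auto simp: negligible_iff_null_sets\<close>)
qed

text \<open>Used twice: with \<open>A\<close> the identity, for almost every parameter, and with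
  \<open>A\<close> constant and \<open>X\<close> the identity, for almost every point.\<close>

lemma AE_digit_dev_tendsto_0:
  fixes A X :: "real \<Rightarrow> real" and U :: "real set"
  assumes U: "open U" and cont: "continuous_on U A"
    and A: "\<And>t. t \<in> U \<Longrightarrow> 0 < A t \<and> A t < 1"
    and sep: "\<And>t0. t0 \<in> U \<Longrightarrow> \<exists>V C. open V \<and> t0 \<in> V \<and> 0 \<le> C \<and>
      (\<forall>s\<in>V. \<forall>t\<in>V. \<forall>n. s < t \<longrightarrow> itinerary (A s) (X s) n = itinerary (A t) (X t) n
        \<longrightarrow> t - s \<le> C * word_prob (A s) (itinerary (A s) (X s) n))"
  shows "AE t in lebesgue. t \<in> U \<longrightarrow> (\<forall>u. (\<lambda>n. digit_dev (A t) (X t) u n / n) \<longlonglongrightarrow> 0)"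
proof -
  \<comment> \<open>One \<open>e\<close> comes from \<open>word_dev\<close>, the other from
    replacing the reference parameter by \<open>A t\<close> as the centre.\<close>
  define good where "good (e :: real) u t \<longleftrightarrow> (\<forall>\<^sub>F n in sequentially. \<bar>digit_dev (A t) (X t) u n\<bar> \<le> 2 * e * n)" for e u t
  have neg: "negligible {t \<in> U. \<not> good e u t}" if e: "e > 0" for e u
  \<comment> \<open>Negligibility is a local property, so the reference parameter and the separation
    constant may depend on \<open>t0\<close>.\<close>
  proof (subst locally_negligible_alt, rule ballI)
    fix t0 assume "t0 \<in> {t \<in> U. \<not> good e u t}"
    then have t0: "t0 \<in> U" "\<not> good e u t0" by auto
    define p where "p = A t0"
    have p: "0 < p" "p < 1" using A t0 by (auto simp: p_def)
    obtain V C where V: "open V" "t0 \<in> V" "0 \<le> C"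
      and sepV: "\<And>s t n. s \<in> V \<Longrightarrow> t \<in> V \<Longrightarrow> s < t \<Longrightarrow> itinerary (A s) (X s) n = itinerary (A t) (X t) n
        \<Longrightarrow> t - s \<le> C * word_prob (A s) (itinerary (A s) (X s) n)"
      using sep[OF t0(1)] by metis
    \<comment> \<open>The exponential bounds compare digit probabilities with those of
      \<open>p\<close>; the bounds \<open>p - e\<close> and \<open>p + e\<close> control the change
      of centre.\<close>
    define I where "I = {max (1 - exp (e\<^sup>2) * (1 - p)) (p - e) <..< min (exp (e\<^sup>2) * p) (p + e)}"
    define W where "W = V \<inter> (U \<inter> A -` I)"
    have "open (U \<inter> A -` I)"
      by (rule continuous_open_preimage[OF cont U]) (simp add: I_def)
    then have W: "open W" unfolding W_def using V by auto
    have "1 < exp (e\<^sup>2)" using e by simp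
    then have "p * 1 < p * exp (e\<^sup>2)" "(1 - p) * 1 < (1 - p) * exp (e\<^sup>2)"
      by (intro mult_strict_left_mono; use p in simp)+
    then have "p \<in> I" using e unfolding I_def by (simp add: mult.commute)
    then have t0W: "t0 \<in> W" using V t0 by (auto simp: W_def p_def)
    have "AE t in lborel. t \<in> W \<longrightarrow>
      (\<forall>\<^sub>F n in sequentially. \<bar>word_dev p u (itinerary (A t) (X t) (n + length u))\<bar> \<le> e * n)"
    proof (rule AE_eventually_word_dev_le[OF p e V(3)])
      fix t assume "t \<in> W"
      then show "0 < A t \<and> A t < 1 \<and> A t \<le> exp (e\<^sup>2) * p \<and> 1 - A t \<le> exp (e\<^sup>2) * (1 - p)"
        using A[of t] by (auto simp: W_def I_def)
    next
      fix s t n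
      assume "s \<in> W" "t \<in> W" "s < t" "itinerary (A s) (X s) n = itinerary (A t) (X t) n"
      then show "t - s \<le> C * word_prob (A s) (itinerary (A s) (X s) n)"
        using sepV[of s t n] by (auto simp: W_def)
    qed
    then have "AE t in lborel. t \<in> W \<longrightarrow> good e u t"
    proof eventually_elim
      case (elim t)
      show ?case
      proof
        assume t: "t \<in> W"
        then have At: "\<bar>A t - p\<bar> \<le> e" by (auto simp: W_def I_def)
        show "good e u t"
          unfolding good_def using elim[rule_format, OF t]
        proof eventually_elim
          case (elim n)
          have "\<bar>A t - p\<bar> * n \<le> e * n" using At by (intro mult_right_mono) auto
          then show ?case using elim digit_dev_word_dev_diff[of "A t" "X t" u n p] by linarith
        qed
      qed
    qed
    then have "negligible {t \<in> W. \<not> good e u t}"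
      by (rule AE_lborel_imp_negligible)
    moreover have "{t \<in> W. \<not> good e u t} = {t \<in> U. \<not> good e u t} \<inter> W"
      by (auto simp: W_def)
    ultimately show "\<exists>Ua. openin (top_of_set {t \<in> U. \<not> good e u t}) Ua \<and> t0 \<in> Ua \<and> negligible Ua"
      using W t0 t0W by (intro exI[of _ "{t \<in> U. \<not> good e u t} \<inter> W"]) auto
  qed
  have "AE t in lebesgue. t \<in> U \<longrightarrow> good (inverse (Suc k)) u t" for k u
    by (rule AE_I'[OF neg[of "inverse (Suc k)" u, unfolded negligible_iff_null_sets]]) auto
  then have "AE t in lebesgue. \<forall>u k. t \<in> U \<longrightarrow> good (inverse (Suc k)) u t"
    unfolding AE_all_countable by blast
  then show ?thesis
  proof eventually_elim
    case (elim t)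
    show ?case
    proof (intro impI allI)
      fix u assume t: "t \<in> U"
      show "(\<lambda>n. digit_dev (A t) (X t) u n / n) \<longlonglongrightarrow> 0"
      proof (rule tendstoI)
        fix e :: real assume "e > 0"
        then obtain k where k: "inverse (Suc k) < e / 2"
          using reals_Archimedean[of "e / 2"] by auto
        have "\<forall>\<^sub>F n in sequentially. \<bar>digit_dev (A t) (X t) u n\<bar> \<le> 2 * inverse (Suc k) * n"
          using elim t by (simp add: good_def)
        then show "\<forall>\<^sub>F n in sequentially. dist (digit_dev (A t) (X t) u n / n) 0 < e"
          using eventually_gt_at_top[of 0]
        proof eventually_elim
          case (elim n)
          then have "\<bar>digit_dev (A t) (X t) u n\<bar> / n \<le> 2 * inverse (Suc k)"
            by (simp add: pos_divide_le_eq)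
          then show ?case using k by simp
        qed
      qed
    qed
  qed
qed

section \<open>From word frequencies to typicality\<close>

text \<open>The shift changes the sum by the bounded amount \<open>g n - g 0\<close>.\<close>

lemma tendsto_average_shift:
  fixes g :: "nat \<Rightarrow> real"
  assumes "(\<lambda>n. (\<Sum>i<n. g i) / n) \<longlonglongrightarrow> L" and "\<And>i. \<bar>g i\<bar> \<le> 1"
  shows "(\<lambda>n. (\<Sum>i<n. g (Suc i)) / n) \<longlonglongrightarrow> L"
proof -
  have "(\<lambda>n. (g n - g 0) / n) \<longlonglongrightarrow> 0"
  proof (rule tendsto_0_le[where K = 1])
    show "(\<lambda>n. 2 / real n) \<longlonglongrightarrow> 0" by (rule lim_const_over_n)
    have "\<bar>g n - g 0\<bar> \<le> 2" for n
      using assms(2)[of n] assms(2)[of 0] by linarith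
    then show "\<forall>\<^sub>F n in sequentially. norm ((g n - g 0) / n) \<le> norm (2 / real n) * 1"
      by (intro always_eventually allI) (simp add: divide_right_mono)
  qed
  moreover have "(\<Sum>i<n. g i) + (g n - g 0) = (\<Sum>i<n. g (Suc i))" for n
    using sum.lessThan_Suc_shift[of g n] by simp
  ultimately show ?thesis
    using tendsto_add[OF assms(1)] by (fastforce simp: add_divide_distrib[symmetric])
qed

text \<open>Induction by prepending a digit: up to a vanishing \<open>digit_dev\<close> term, the
  frequency of \<open>d # u\<close> is the probability of \<open>d\<close> times the shifted
  frequency of \<open>u\<close>.\<close>

lemma tendsto_word_frequency:
  assumes "\<And>u. (\<lambda>n. digit_dev a x u n / n) \<longlonglongrightarrow> 0"
  shows "(\<lambda>n. (\<Sum>i<n. of_bool (itinerary a ((T a ^^ i) x) (length u) = u)) / real n) \<longlonglongrightarrow> word_prob a u"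
proof (induction u)
  case Nil
  have "\<forall>\<^sub>F n in sequentially. 1 = (\<Sum>i<n. of_bool (itinerary a ((T a ^^ i) x) (length []) = [])) / real n"
    using eventually_gt_at_top[of 0] by eventually_elim simp
  from Lim_transform_eventually[OF _ this] show ?case by simp
next
  case (Cons d u)
  let ?g = "\<lambda>i. of_bool (itinerary a ((T a ^^ i) x) (length u) = u) :: real"
  have sh: "(\<lambda>n. (\<Sum>i<n. ?g (Suc i)) / real n) \<longlonglongrightarrow> word_prob a u"
    by (rule tendsto_average_shift[OF Cons]) simp
  define q where "q = (if d then a else 1 - a)"
  \<comment> \<open>The indicator of the digit \<open>d\<close> is \<open>q\<close> plus
    \<open>s\<close> times the centred indicator of the left branch.\<close>
  define s :: real where "s = (if d then 1 else - 1)"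
  have "of_bool (itinerary a ((T a ^^ i) x) (length (d # u)) = d # u) =
     s * ((of_bool ((T a ^^ i) x < a) - a) * ?g (Suc i)) + q * ?g (Suc i)" for i
    by (auto simp: q_def s_def)
  then have "(\<lambda>n. (\<Sum>i<n. of_bool (itinerary a ((T a ^^ i) x) (length (d # u)) = d # u)) / real n) =
     (\<lambda>n. s * (digit_dev a x u n / n) + q * ((\<Sum>i<n. ?g (Suc i)) / real n))"
    unfolding digit_dev_def by (simp only: sum.distrib sum_distrib_left[symmetric] add_divide_distrib times_divide_eq_right)
  also have "\<dots> \<longlonglongrightarrow> s * 0 + q * word_prob a u"
    by (intro tendsto_intros assms sh)
  finally show ?case by (simp add: q_def)
qed

section \<open>Integrals over cylinders and orbit averages\<close>

text \<open>Affine substitution on \<open>{0..a}\<close> and \<open>{a..1}\<close>.\<close>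

lemma integral_affine_split:
  fixes f :: "real \<Rightarrow> real"
  assumes a: "0 < a" "a < 1" and f: "continuous_on {0..1} f"
  shows "integral {0..1} f =
    a * integral {0..1} (\<lambda>y. f (a * y)) + (1 - a) * integral {0..1} (\<lambda>y. f (a + (1 - a) * y))"
proof -
  have int: "f integrable_on {0..a}" "f integrable_on {a..1}" "f integrable_on {0..1}"
    using a by (auto intro!: integrable_continuous_real continuous_on_subset[OF f])
  have "((\<lambda>x. f (a *\<^sub>R x + 0)) has_integral (integral {0..a} f /\<^sub>R a ^ DIM(real)))
           (cbox ((0 - 0) /\<^sub>R a) ((a - 0) /\<^sub>R a))"
    using integrable_integral[OF int(1)] a by (intro has_integral_affinity') auto
  then have 1: "integral {0..1} (\<lambda>y. f (a * y)) = integral {0..a} f / a"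
    using a by (simp add: field_simps integral_unique)
  have "((\<lambda>x. f ((1 - a) *\<^sub>R x + a)) has_integral (integral {a..1} f /\<^sub>R (1 - a) ^ DIM(real)))
           (cbox ((a - a) /\<^sub>R (1 - a)) ((1 - a) /\<^sub>R (1 - a)))"
    using integrable_integral[OF int(2)] a by (intro has_integral_affinity') auto
  then have 2: "integral {0..1} (\<lambda>y. f (a + (1 - a) * y)) = integral {a..1} f / (1 - a)"
    using a by (simp add: field_simps integral_unique)
  have "integral {0..1} f = integral {0..a} f + integral {a..1} f"
    using a int by (simp add: Henstock_Kurzweil_Integration.integral_combine)
  then show ?thesis using 1 2 a by simp
qed

lemma continuous_on_branch:
  fixes f :: "real \<Rightarrow> real"
  assumes "0 < a" "a < 1" "continuous_on {0..1} f"
  shows "continuous_on {0..1} (\<lambda>y. f (branch a w y))"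
proof -
  have "continuous_on {0..1} (branch a w)"
  proof (induction w)
    case (Cons d w)
    then show ?case by (cases d) (auto intro!: continuous_intros)
  qed (simp add: continuous_on_id)
  then show ?thesis
    by (rule continuous_on_compose2[OF assms(3)]) (use branch_in_unit[OF assms(1,2)] in blast)
qed

lemma integral_words:
  fixes f :: "real \<Rightarrow> real"
  assumes a: "0 < a" "a < 1" and f: "continuous_on {0..1} f"
  shows "integral {0..1} f = (\<Sum>w\<in>words n. word_prob a w * integral {0..1} (\<lambda>y. f (branch a w y)))"
  using f
proof (induction n arbitrary: f)
  case (Suc n)
  have c: "continuous_on {0..1} (\<lambda>y. f (a * y))" "continuous_on {0..1} (\<lambda>y. f (a + (1 - a) * y))"
    using continuous_on_branch[OF a Suc(2), of "[True]"] continuous_on_branch[OF a Suc(2), of "[False]"] by simp_all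
  show ?case
    unfolding integral_affine_split[OF a Suc(2)] Suc(1)[OF c(1)] Suc(1)[OF c(2)] sum_words_Suc
    by (simp add: sum.distrib sum_distrib_left mult_ac)
qed simp

lemma sum_word_prob_words:
  assumes "0 < a" "a < 1" shows "(\<Sum>w\<in>words n. word_prob a w) = 1"
  using integral_words[OF assms, of "\<lambda>_. 1" n] by simp

text \<open>\<open>f\<close> is nearly constant on the cylinders of a large length \<open>m\<close>.
  One third of \<open>e\<close> each goes to sampling \<open>f\<close> along the orbit, to the
  convergence of the finitely many word frequencies, and to sampling \<open>f\<close> in the
  integral.\<close>

lemma tendsto_orbit_average:
  fixes f :: "real \<Rightarrow> real"
  assumes a: "0 < a" "a < 1" and x: "x \<in> {0..1}" and f: "continuous_on {0..1} f"
    and digit_dev: "\<And>u. (\<lambda>n. digit_dev a x u n / n) \<longlonglongrightarrow> 0"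
  shows "(\<lambda>n. (\<Sum>i<n. f ((T a ^^ i) x)) / n) \<longlonglongrightarrow> integral {0..1} f"
proof (rule tendstoI)
  fix e :: real assume e: "0 < e"
  define y where "y i = (T a ^^ i) x" for i
  have y: "y i \<in> {0..1}" for i unfolding y_def by (rule funpow_T_in_unit[OF a x])
  have "uniformly_continuous_on {0..1} f"
    using f by (rule compact_uniformly_continuous) simp
  then obtain d where d: "d > 0" "\<And>s t. s \<in> {0..1} \<Longrightarrow> t \<in> {0..1} \<Longrightarrow> \<bar>s - t\<bar> < d \<Longrightarrow> \<bar>f s - f t\<bar> < e / 3"
    using e unfolding uniformly_continuous_on_def dist_real_def by (metis divide_pos_pos zero_less_numeral)
  obtain m where m: "max a (1 - a) ^ m < d"
    using real_arch_pow_inv[of d "max a (1 - a)"] a d(1) by auto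
  \<comment> \<open>\<open>branch a w 0\<close>, the left end of the cylinder of \<open>w\<close>,
    is the sample point.\<close>
  have close: "\<bar>f (branch a w s) - f (branch a w 0)\<bar> \<le> e / 3" if "s \<in> {0..1}" "length w = m" for s w
  proof -
    have "\<bar>branch a w s - branch a w 0\<bar> = word_prob a w * s"
      using that word_prob_pos[OF a, of w] by (simp add: branch_diff abs_mult)
    also have "\<dots> \<le> word_prob a w * 1"
      using that word_prob_pos[OF a, of w] by (intro mult_left_mono) auto
    also have "\<dots> < d" using word_prob_le_power[OF a, of w] m that by simp
    finally show ?thesis
      using d(2)[of "branch a w s" "branch a w 0"] branch_in_unit[OF a] that by (auto intro: less_imp_le)
  qed
  \<comment> \<open>The Riemann sum of \<open>f\<close> over the cylinders of length
    \<open>m\<close>.\<close>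
  define L where "L = (\<Sum>w\<in>words m. f (branch a w 0) * word_prob a w)"
  define F where "F w n = (\<Sum>i<n. of_bool (itinerary a (y i) m = w)) / real n" for w n
  have "(\<lambda>n. \<Sum>w\<in>words m. f (branch a w 0) * F w n) \<longlonglongrightarrow> L"
    unfolding L_def F_def y_def
    by (intro tendsto_sum tendsto_mult tendsto_const)
      (use tendsto_word_frequency[OF digit_dev] in \<open>auto simp: words_def\<close>)
  then have ev: "\<forall>\<^sub>F n in sequentially. \<bar>(\<Sum>w\<in>words m. f (branch a w 0) * F w n) - L\<bar> < e / 3"
    using e by (auto dest!: tendstoD[where e = "e / 3"] simp: dist_real_def)
  have L: "\<bar>L - integral {0..1} f\<bar> \<le> e / 3"
  proof -
    have "integral {0..1} f - L =
      (\<Sum>w\<in>words m. word_prob a w * (integral {0..1} (\<lambda>y. f (branch a w y)) - f (branch a w 0)))"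
      unfolding integral_words[OF a f, of m] L_def
      by (simp add: sum_subtractf[symmetric] algebra_simps)
    also have "\<bar>\<dots>\<bar> \<le> (\<Sum>w\<in>words m. word_prob a w * (e / 3))"
    proof (rule sum_abs[THEN order.trans], rule sum_mono)
      fix w assume w: "w \<in> words m"
      have c: "continuous_on {0..1} (\<lambda>y. f (branch a w y) - f (branch a w 0))"
        by (rule continuous_on_diff[OF continuous_on_branch[OF a f] continuous_on_const])
      have "integral {0..1} (\<lambda>y. f (branch a w y)) - f (branch a w 0) = integral {0..1} (\<lambda>y. f (branch a w y) - f (branch a w 0))"
        using integral_diff[OF integrable_continuous_real[OF continuous_on_branch[OF a f, of w]]
          integrable_continuous_real[OF continuous_on_const[of "{0..1}" "f (branch a w 0)"]]] by simp
      also have "norm \<dots> \<le> e / 3 * (1 - 0)"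
        by (rule integral_bound) (use c close w in \<open>auto simp: words_def\<close>)
      finally show "\<bar>word_prob a w * (integral {0..1} (\<lambda>y. f (branch a w y)) - f (branch a w 0))\<bar> \<le> word_prob a w * (e / 3)"
        using word_prob_pos[OF a, of w] by (simp add: abs_mult)
    qed
    also have "\<dots> = e / 3" unfolding sum_distrib_right[symmetric] sum_word_prob_words[OF a] by simp
    finally show ?thesis by (simp add: abs_minus_commute)
  qed
  have close_avg: "\<bar>(\<Sum>i<n. f (y i)) / n - (\<Sum>w\<in>words m. f (branch a w 0) * F w n)\<bar> \<le> e / 3" if "n > 0" for n
  proof -
    have "(\<Sum>w\<in>words m. f (branch a w 0) * F w n)
      = (\<Sum>i<n. \<Sum>w\<in>words m. f (branch a w 0) * of_bool (itinerary a (y i) m = w)) / n"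
      unfolding F_def sum_divide_distrib sum_distrib_left by (subst sum.swap) simp
    also have "(\<Sum>i<n. \<Sum>w\<in>words m. f (branch a w 0) * of_bool (itinerary a (y i) m = w))
      = (\<Sum>i<n. f (branch a (itinerary a (y i) m) 0))"
      by (intro sum.cong refl, subst sum.remove[where x = "itinerary a _ m"])
        (auto simp: words_def[of m] finite_words[unfolded words_def] intro!: sum.neutral)
    finally have "(\<Sum>i<n. f (y i)) / n - (\<Sum>w\<in>words m. f (branch a w 0) * F w n)
      = (\<Sum>i<n. f (y i) - f (branch a (itinerary a (y i) m) 0)) / n"
      by (simp add: sum_subtractf diff_divide_distrib)
    moreover have "\<bar>\<Sum>i<n. f (y i) - f (branch a (itinerary a (y i) m) 0)\<bar> \<le> (\<Sum>i<n. e / 3)"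
    proof (rule sum_abs[THEN order.trans], rule sum_mono)
      fix i
      show "\<bar>f (y i) - f (branch a (itinerary a (y i) m) 0)\<bar> \<le> e / 3"
        using close[of "(T a ^^ m) (y i)" "itinerary a (y i) m"] branch_itinerary[OF a, where n = m and x = "y i"]
          funpow_T_in_unit[OF a y] by simp
    qed
    ultimately show ?thesis using that by (simp add: abs_divide pos_divide_le_eq mult.commute)
  qed
  from ev eventually_gt_at_top[of 0]
  show "\<forall>\<^sub>F n in sequentially. dist ((\<Sum>i<n. f ((T a ^^ i) x)) / n) (integral {0..1} f) < e"
  proof eventually_elim
    case (elim n)
    then show ?case using close_avg[of n] L unfolding dist_real_def y_def[symmetric] by linarith
  qed
qed

section \<open>Empirical measures and weak convergence\<close>

text \<open>The empirical measure is the image of the uniform measure on \<open>{..<n}\<close> under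
  the orbit map, which turns the integral into a finite average.\<close>

lemma integral_empirical:
  fixes f :: "real \<Rightarrow> real"
  assumes n: "n > 0" and S: "\<And>i. (S ^^ i) x \<in> {0..1}" and f: "f \<in> borel_measurable borel01"
  shows "(\<integral>y. f y \<partial>empirical S x n) = (\<Sum>i<n. f ((S ^^ i) x)) / n"
proof -
  have mf: "(\<lambda>i. (S ^^ i) x) \<in> measurable (uniform_count_measure {..<n}) borel01"
    using S by (auto simp: measurable_def space_restrict_space sets_uniform_count_measure space_uniform_count_measure)
  have "empirical S x n = distr (uniform_count_measure {..<n}) borel01 (\<lambda>i. (S ^^ i) x)"
  proof (rule measure_eqI)
    fix A assume "A \<in> sets (empirical S x n)"
    then have A: "A \<in> sets borel01" by simp
    have "emeasure (distr (uniform_count_measure {..<n}) borel01 (\<lambda>i. (S ^^ i) x)) A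
      = ennreal (card {i\<in>{..<n}. (S ^^ i) x \<in> A} / n)"
      using mf A by (simp add: emeasure_distr emeasure_uniform_count_measure space_uniform_count_measure
        vimage_def Int_def conj_commute subset_eq)
    also have "card {i\<in>{..<n}. (S ^^ i) x \<in> A} = (\<Sum>i<n. indicator A ((S ^^ i) x) :: nat)"
      by (simp add: indicator_def sum.If_cases Int_def)
    also have "ennreal (real \<dots> / n) = of_nat (\<Sum>i<n. indicator A ((S ^^ i) x)) / of_nat n"
      unfolding ennreal_of_nat_eq_real_of_nat by (rule divide_ennreal[symmetric]) (use n in \<open>auto intro: sum_nonneg\<close>)
    also have "of_nat (\<Sum>i<n. indicator A ((S ^^ i) x)) = (\<Sum>i<n. indicator A ((S ^^ i) x) :: ennreal)"
      by (simp add: of_nat_sum indicator_def)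
    also have "(\<Sum>i<n. indicator A ((S ^^ i) x)) / of_nat n = emeasure (empirical S x n) A"
      using A by (simp add: emeasure_empirical)
    finally show "emeasure (empirical S x n) A
      = emeasure (distr (uniform_count_measure {..<n}) borel01 (\<lambda>i. (S ^^ i) x)) A" ..
  qed simp
  then show ?thesis
    using f mf n by (simp add: integral_distr integral_uniform_count_measure)
qed

lemma integral_lebesgue01:
  fixes f :: "real \<Rightarrow> real"
  assumes "continuous_on {0..1} f"
  shows "(\<integral>y. f y \<partial>lebesgue01) = integral {0..1} f"
proof -
  have "set_integrable lborel {0..1} f"
    by (rule borel_integrable_compact[folded set_integrable_def]) (use assms in auto)
  from set_borel_integral_eq_integral(2)[OF this] show ?thesis
    by (simp add: integral_restrict_space set_lebesgue_integral_def)
qed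

lemma typical_lebesgue01:
  assumes a: "0 < a" "a < 1" and x: "x \<in> {0..1}"
    and digit_dev: "\<And>u. (\<lambda>n. digit_dev a x u n / n) \<longlonglongrightarrow> 0"
  shows "typical (T a) lebesgue01 x"
  unfolding typical_def weak_star_conv_def
proof (intro allI impI)
  fix f :: "real \<Rightarrow> real" assume f: "continuous_on {0..1} f"
  have "\<forall>\<^sub>F n in sequentially. (\<Sum>i<n. f ((T a ^^ i) x)) / n = (\<integral>y. f y \<partial>empirical (T a) x n)"
    using eventually_gt_at_top[of 0]
    by eventually_elim (use integral_empirical funpow_T_in_unit[OF a x]
        borel_measurable_continuous_on_restrict[OF f] in metis)
  from Lim_transform_eventually[OF tendsto_orbit_average[OF a x f digit_dev] this]
  show "(\<lambda>n. \<integral>y. f y \<partial>empirical (T a) x n) \<longlonglongrightarrow> (\<integral>y. f y \<partial>lebesgue01)"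
    by (simp add: integral_lebesgue01[OF f])
qed

section \<open>Separation of parameters and uniqueness of the invariant measure\<close>

text \<open>Raising the parameter moves the orbit of a point with a given itinerary down, so as long as the
  digits agree the gap between the two orbits grows at least by the slope of the map with the smaller
  parameter.\<close>

lemma itinerary_eq_imp_diff_le:
  assumes s: "0 < s" "s < t" "t < 1" and x: "x \<in> {0..1}" and y: "y \<in> {0..1}" "y \<le> x"
    and eq: "itinerary s x n = itinerary t y n"
  shows "x - y \<le> word_prob s (itinerary s x n) * ((T s ^^ n) x - (T t ^^ n) y)"
  using x y eq
proof (induction n arbitrary: x y)
  case (Suc n)
  let ?d = "x < s"
  define q where "q = (if ?d then s else 1 - s)"
  have q: "0 < q" using s by (auto simp: q_def)
  have d: "(x < s) = (y < t)" and eq: "itinerary s (T s x) n = itinerary t (T t y) n"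
    using Suc.prems by auto
  \<comment> \<open>For fixed \<open>y\<close> both branch formulas decrease in the parameter, so
    \<open>T t y\<close> lies below the value at \<open>y\<close> of the branch of
    \<open>T s\<close> with the same digit.\<close>
  have step: "x - y \<le> q * (T s x - T t y)"
  proof (cases ?d)
    case True
    have "y * s \<le> y * t" using s Suc.prems by (intro mult_left_mono) auto
    then have "s * (y / t) \<le> y" using s by (simp add: field_simps)
    moreover have "q * T s x = x" "q * T t y = s * (y / t)" using True d s by (simp_all add: q_def T_def)
    ultimately show ?thesis unfolding right_diff_distrib[of q] by linarith
  next
    case False
    have "(1 - y) * (1 - t) \<le> (1 - y) * (1 - s)" using s Suc.prems by (intro mult_left_mono) auto
    then have "(1 - s) * ((y - t) / (1 - t)) \<le> y - s"
      using s by (simp add: field_simps)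
    moreover have "q * T s x = x - s" "q * T t y = (1 - s) * ((y - t) / (1 - t))"
      using False d s by (simp_all add: q_def T_def)
    ultimately show ?thesis unfolding right_diff_distrib[of q] by linarith
  qed
  \<comment> \<open>The images keep their order, as the induction hypothesis demands.\<close>
  have "0 \<le> q * (T s x - T t y)" using step Suc.prems by simp
  then have le: "T t y \<le> T s x" using q by (simp add: zero_le_mult_iff)
  have "T s x - T t y \<le> word_prob s (itinerary s (T s x) n) * ((T s ^^ n) (T s x) - (T t ^^ n) (T t y))"
    by (rule Suc.IH) (use Suc.prems s le eq T_in_unit[of s x] T_in_unit[of t y] in auto)
  then have "q * (T s x - T t y) \<le> q * (word_prob s (itinerary s (T s x) n) * ((T s ^^ n) (T s x) - (T t ^^ n) (T t y)))"
    using q by (intro mult_left_mono) auto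
  also have "\<dots> = word_prob s (itinerary s x (Suc n)) * ((T s ^^ Suc n) x - (T t ^^ Suc n) y)"
    by (simp add: q_def funpow_Suc_right mult_ac del: funpow.simps)
  finally show ?case using step by linarith
qed simp

text \<open>The first step turns the parameter gap \<open>t - s\<close> into a gap between the orbits, even when \<open>x = y\<close>.\<close>

lemma itinerary_eq_imp_parameter_close:
  assumes s: "0 < s" "s < t" "t < 1" and x: "x \<in> {0..1}" and y: "y \<in> {0..1}" "y \<le> x"
    and c: "0 < c" "c \<le> y" "c \<le> 1 - y"
    and eq: "itinerary s x n = itinerary t y n"
  shows "t - s \<le> max 1 (1 / c) * word_prob s (itinerary s x n)"
proof (cases n)
  case 0
  \<comment> \<open>The empty word has probability 1 and \<open>t - s\<close> is below 1; hence the
    maximum with 1 in the constant.\<close>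
  have "1 * 1 \<le> max 1 (1 / c) * 1" by (intro mult_right_mono) auto
  then show ?thesis using 0 s by simp
next
  case (Suc m)
  let ?d = "x < s"
  define q where "q = (if ?d then s else 1 - s)"
  have q: "0 < q" using s by (auto simp: q_def)
  have d: "(x < s) = (y < t)" and eq': "itinerary s (T s x) m = itinerary t (T t y) m"
    using eq Suc by auto
  \<comment> \<open>The left branch fixes \<open>0\<close> and the right branch fixes
    \<open>1\<close> for every parameter. Keeping \<open>y\<close> at distance \<open>c\<close> from
    both makes the drift at least proportional to \<open>t - s\<close>.\<close>
  have step: "c * (t - s) \<le> q * (T s x - T t y)"
  proof (cases ?d)
    case True
    have "c * (t - s) * t \<le> y * (t - s) * 1"
      using c s by (intro mult_mono mult_right_mono) auto
    then have "c * (t - s) \<le> y * (t - s) / t" using s by (simp add: pos_le_divide_eq)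
    also have "\<dots> = y - s * (y / t)" using s by (simp add: field_simps)
    finally have le: "c * (t - s) \<le> y - s * (y / t)" .
    have "q * T s x = x" "q * T t y = s * (y / t)" using True d s by (simp_all add: q_def T_def)
    then show ?thesis using le y unfolding right_diff_distrib[of q] by linarith
  next
    case False
    have "c * (t - s) * (1 - t) \<le> (1 - y) * (t - s) * 1"
      using c s by (intro mult_mono mult_right_mono) auto
    then have "c * (t - s) \<le> (1 - y) * (t - s) / (1 - t)" using s by (simp add: pos_le_divide_eq)
    also have "\<dots> = y - s - (1 - s) * ((y - t) / (1 - t))" using s by (simp add: field_simps)
    finally have le: "c * (t - s) \<le> y - s - (1 - s) * ((y - t) / (1 - t))" .
    have "q * T s x = x - s" "q * T t y = (1 - s) * ((y - t) / (1 - t))"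
      using False d s by (simp_all add: q_def T_def)
    then show ?thesis using le y unfolding right_diff_distrib[of q] by linarith
  qed
  have unit: "T s x \<in> {0..1}" "T t y \<in> {0..1}" using T_in_unit s x y by auto
  have "0 \<le> c * (t - s)" using c s by simp
  then have "0 \<le> q * (T s x - T t y)" using step by linarith
  then have le: "T t y \<le> T s x" using q by (simp add: zero_le_mult_iff)
  have "T s x - T t y \<le> word_prob s (itinerary s (T s x) m) * ((T s ^^ m) (T s x) - (T t ^^ m) (T t y))"
    by (rule itinerary_eq_imp_diff_le[OF s unit le eq'])
  also have "\<dots> \<le> word_prob s (itinerary s (T s x) m) * 1"
    using funpow_T_in_unit[of s "T s x" m] funpow_T_in_unit[of t "T t y" m] unit s word_prob_pos[of s "itinerary s (T s x) m"]
    by (intro mult_left_mono) auto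
  finally have "q * (T s x - T t y) \<le> q * word_prob s (itinerary s (T s x) m)"
    using q by simp
  also have "\<dots> = word_prob s (itinerary s x n)" by (simp add: Suc q_def)
  finally have "c * (t - s) \<le> word_prob s (itinerary s x n)" using step by linarith
  then have "t - s \<le> 1 / c * word_prob s (itinerary s x n)" using c by (simp add: field_simps)
  also have "\<dots> \<le> max 1 (1 / c) * word_prob s (itinerary s x n)"
    using s word_prob_pos[of s "itinerary s x n"] by (intro mult_right_mono) auto
  finally show ?thesis .
qed

lemma AE_parameter_digit_dev_tendsto_0:
  fixes X :: "real \<Rightarrow> real"
  assumes X: "\<And>a. a \<in> {0<..<1} \<Longrightarrow> X a \<in> {0<..<1}"
    and anti: "\<And>s t. 0 < s \<Longrightarrow> s \<le> t \<Longrightarrow> t < 1 \<Longrightarrow> X t \<le> X s"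
  shows "AE a in lebesgue. a \<in> {0<..<1} \<longrightarrow> (\<forall>u. (\<lambda>n. digit_dev a (X a) u n / n) \<longlonglongrightarrow> 0)"
proof (rule AE_digit_dev_tendsto_0)
  fix a :: real assume a: "a \<in> {0<..<1}"
  define l r where "l = a / 2" and "r = (a + 1) / 2"
  have lr: "0 < l" "l < a" "a < r" "r < 1" using a by (auto simp: l_def r_def)
  \<comment> \<open>As \<open>X\<close> decreases, all its values on \<open>{l<..<r}\<close> lie
    between \<open>X r\<close> and \<open>X l\<close>, so one \<open>c\<close> serves the whole
    neighbourhood.\<close>
  define c where "c = min (X r) (1 - X l)"
  have c: "0 < c" using X[of r] X[of l] lr by (auto simp: c_def)
  show "\<exists>V C. open V \<and> a \<in> V \<and> 0 \<le> C \<and>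
      (\<forall>s\<in>V. \<forall>t\<in>V. \<forall>n. s < t \<longrightarrow> itinerary s (X s) n = itinerary t (X t) n
        \<longrightarrow> t - s \<le> C * word_prob s (itinerary s (X s) n))"
  proof (intro exI[of _ "{l<..<r}"] exI[of _ "max 1 (1 / c)"] conjI ballI allI impI)
    fix s t n assume st: "s \<in> {l<..<r}" "t \<in> {l<..<r}" "s < t" and eq: "itinerary s (X s) n = itinerary t (X t) n"
    have "X r \<le> X t" "X t \<le> X l" "X t \<le> X s"
      using st lr by (auto intro!: anti)
    moreover have "s \<in> {0<..<1}" "t \<in> {0<..<1}" using st lr by auto
    moreover from this have "X s \<in> {0<..<1}" "X t \<in> {0<..<1}" by (auto simp only: X)
    ultimately show "t - s \<le> max 1 (1 / c) * word_prob s (itinerary s (X s) n)"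
      using st lr c eq by (intro itinerary_eq_imp_parameter_close[where y = "X t"]) (auto simp: c_def)
  qed (use lr in auto)
qed auto

text \<open>With the parameter fixed, points with the same itinerary lie in one cylinder, so
  separation holds with constant 1.\<close>

lemma AE_point_digit_dev_tendsto_0:
  assumes a: "0 < a" "a < 1"
  shows "AE x in lebesgue. x \<in> {0<..<1} \<longrightarrow> (\<forall>u. (\<lambda>n. digit_dev a x u n / n) \<longlonglongrightarrow> 0)"
proof (rule AE_digit_dev_tendsto_0[where A = "\<lambda>_. a" and X = "\<lambda>x. x"])
  fix x :: real assume x: "x \<in> {0<..<1}"
  show "\<exists>V C. open V \<and> x \<in> V \<and> 0 \<le> C \<and>
      (\<forall>s\<in>V. \<forall>t\<in>V. \<forall>n. s < t \<longrightarrow> itinerary a s n = itinerary a t n \<longrightarrow> t - s \<le> C * word_prob a (itinerary a s n))"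
  proof (intro exI[of _ "{0<..<1}"] exI[of _ "1::real"] conjI ballI allI impI)
    fix s t :: real and n :: nat assume st: "s \<in> {0<..<1}" "t \<in> {0<..<1}" "s < t" and eq: "itinerary a s n = itinerary a t n"
    let ?w = "itinerary a s n"
    have "t - s = branch a ?w ((T a ^^ n) t) - branch a ?w ((T a ^^ n) s)"
      using branch_itinerary[OF a, where n = n and x = s] branch_itinerary[OF a, where n = n and x = t] eq by simp
    also have "\<dots> = word_prob a ?w * ((T a ^^ n) t - (T a ^^ n) s)" by (rule branch_diff)
    also have "\<dots> \<le> word_prob a ?w * 1"
      using funpow_T_in_unit[OF a, of s n] funpow_T_in_unit[OF a, of t n] st word_prob_pos[OF a, of ?w]
      by (intro mult_left_mono) auto
    finally show "t - s \<le> 1 * word_prob a ?w" by simp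
  qed (use x in auto)
qed (use a in auto)

section \<open>Lebesgue measure as the unique absolutely continuous invariant probability\<close>

lemma prob_lebesgue01: "prob_space lebesgue01"
  by (rule prob_spaceI) (simp add: emeasure_restrict_space space_restrict_space)

text \<open>Pushing both measures forward to the real line makes uniqueness of distribution
  functions applicable.\<close>

lemma measure_borel01_eqI:
  assumes M: "prob_space M" "sets M = sets borel01" and N: "prob_space N" "sets N = sets borel01"
    and eq: "\<And>y. measure M ({0..1} \<inter> {..y}) = measure N ({0..1} \<inter> {..y})"
  shows "M = N"
proof -
  have sp: "space M = {0..1}" "space N = {0..1}"
    using sets_eq_imp_space_eq[OF M(2)] sets_eq_imp_space_eq[OF N(2)] by (auto simp: space_restrict_space)
  have id: "(\<lambda>x. x) \<in> borel_measurable borel01"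
    by (rule measurable_restrict_space1) simp
  then have idM: "(\<lambda>x. x) \<in> borel_measurable M" and idN: "(\<lambda>x. x) \<in> borel_measurable N"
    using measurable_cong_sets[OF M(2) refl] measurable_cong_sets[OF N(2) refl] by blast+
  have "distr M borel (\<lambda>x. x) = distr N borel (\<lambda>x. x)"
  proof (rule cdf_unique)
    show "real_distribution (distr M borel (\<lambda>x. x))" "real_distribution (distr N borel (\<lambda>x. x))"
      using prob_space.real_distribution_distr M N idM idN by blast+
    show "cdf (distr M borel (\<lambda>x. x)) = cdf (distr N borel (\<lambda>x. x))"
      using eq by (intro ext) (simp add: cdf_def measure_distr idM idN sp vimage_def Int_commute[of "{..y}" for y] atMost_def[symmetric])
  qed
  note * = this
  show ?thesis
  proof (rule measure_eqI)
    fix A assume "A \<in> sets M"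
    then have A: "A \<in> sets borel01" using M by simp
    then have "A \<subseteq> {0..1}" "A \<in> sets borel" by (auto simp: sets_restrict_space)
    then have "emeasure (distr M borel (\<lambda>x. x)) A = emeasure M A" "emeasure (distr N borel (\<lambda>x. x)) A = emeasure N A"
      by (simp_all add: emeasure_distr idM idN sp Int_absorb2)
    then show "emeasure M A = emeasure N A" using * by simp
  qed (use M N in simp)
qed

lemma measurable_T:
  assumes "0 < a" "a < 1" shows "T a \<in> measurable borel01 borel01"
proof (rule measurable_restrict_space3)
  show "T a \<in> borel \<rightarrow>\<^sub>M borel" unfolding T_def by measurable
  show "T a \<in> {0..1} \<rightarrow> {0..1}" using T_in_unit[OF assms] by auto
qed

text \<open>For \<open>y\<close> in the unit interval, the preimage of \<open>{0..y}\<close>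
  consists of one interval per branch, of lengths \<open>a * y\<close> and
  \<open>(1 - a) * y\<close>.\<close>

lemma distr_lebesgue01_T:
  assumes a: "0 < a" "a < 1"
  shows "distr lebesgue01 lebesgue01 (T a) = lebesgue01"
proof (rule measure_borel01_eqI)
  have sets: "sets lebesgue01 = sets borel01" by (simp add: sets_restrict_space)
  have T: "T a \<in> measurable lebesgue01 lebesgue01"
    using measurable_T[OF a] measurable_cong_sets[OF sets sets] by blast
  show "prob_space (distr lebesgue01 lebesgue01 (T a))"
    by (rule prob_space.prob_space_distr[OF prob_lebesgue01 T])
  fix y :: real
  have m: "measure lebesgue01 A = measure lborel A" if "A \<subseteq> {0..1}" for A
    using that by (intro measure_restrict_space) auto
  have y: "{0..1} \<inter> {..y} \<in> sets lebesgue01"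
    unfolding sets_restrict_space by (rule imageI) simp
  have "measure (distr lebesgue01 lebesgue01 (T a)) ({0..1} \<inter> {..y})
     = measure lebesgue01 (T a -` ({0..1} \<inter> {..y}) \<inter> {0..1})"
    unfolding measure_distr[OF T y] by (simp only: space_restrict_space space_lborel space_borel Int_UNIV_right)
  also have "T a -` ({0..1} \<inter> {..y}) \<inter> {0..1} = {x \<in> {0..1}. T a x \<le> y}"
    using T_in_unit[OF a] by (intro set_eqI) (simp only: vimage_eq Int_iff atMost_iff mem_Collect_eq, blast)
  also have "measure lebesgue01 {x \<in> {0..1}. T a x \<le> y} = measure lborel {x \<in> {0..1}. T a x \<le> y}"
    by (rule m) auto
  also have "\<dots> = measure lborel ({0..1} \<inter> {..y})"
  proof -
    consider "y < 0" | "0 \<le> y" "y < 1" | "1 \<le> y" by linarith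
    then show ?thesis
    proof cases
      case 1
      then have "\<not> T a x \<le> y" if "x \<in> {0..1}" for x
        using T_in_unit[OF a that] by simp
      then have "{x \<in> {0..1}. T a x \<le> y} = {}" by blast
      moreover have "{0..1} \<inter> {..y} = {}" using 1 by auto
      ultimately show ?thesis by (simp only:)
    next
      case 2
      \<comment> \<open>Strictness, due to \<open>y < 1\<close>, makes the two closed intervals
        disjoint.\<close>
      have ay: "a * y < a" "(1 - a) * y < 1 - a" "0 \<le> a * y" "0 \<le> (1 - a) * y"
        using a 2 by simp_all
      have "{x \<in> {0..1}. T a x \<le> y} = {0..a * y} \<union> {a..a + (1 - a) * y}"
      proof (rule set_eqI)
        fix x
        show "x \<in> {x \<in> {0..1}. T a x \<le> y} \<longleftrightarrow> x \<in> {0..a * y} \<union> {a..a + (1 - a) * y}"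
        proof (cases "x < a")
          case True
          then have "T a x \<le> y \<longleftrightarrow> x \<le> a * y" using a by (simp add: T_def field_simps)
          then show ?thesis using True a ay by auto
        next
          case False
          then have "T a x \<le> y \<longleftrightarrow> x \<le> a + (1 - a) * y" using a by (simp add: T_def field_simps)
          moreover have "a + (1 - a) * y < 1" using ay by linarith
          ultimately show ?thesis using False a ay by auto
        qed
      qed
      moreover have "measure lborel ({0..a * y} \<union> {a..a + (1 - a) * y}) = a * y + (1 - a) * y"
        using ay by (subst measure_Un2) (auto simp: Diff_triv fmeasurable_def emeasure_lborel_Icc_eq)
      moreover have "{0..1} \<inter> {..y} = {0..y}" using 2 by auto
      ultimately show ?thesis using 2 by (simp add: algebra_simps)
    next
      case 3
      then have "T a x \<le> y" if "x \<in> {0..1}" for x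
        using T_in_unit[OF a that] by simp
      then have "{x \<in> {0..1}. T a x \<le> y} = {0..1}" by blast
      moreover have "{0..1} \<inter> {..y} = {0..1}" using 3 by auto
      ultimately show ?thesis by (simp only:)
    qed
  qed
  also have "\<dots> = measure lebesgue01 ({0..1} \<inter> {..y})"
    by (rule m[symmetric]) auto
  finally show "measure (distr lebesgue01 lebesgue01 (T a)) ({0..1} \<inter> {..y}) = measure lebesgue01 ({0..1} \<inter> {..y})" .
qed (auto simp: sets_restrict_space prob_lebesgue01)

lemma acip_lebesgue01:
  assumes a: "0 < a" "a < 1" shows "acip (T a) lebesgue01"
proof -
  have sets: "sets lebesgue01 = sets borel01" by (simp add: sets_restrict_space)
  then have "T a \<in> measurable lebesgue01 lebesgue01"
    using measurable_T[OF a] measurable_cong_sets[OF sets sets] by blast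
  then show ?thesis
    using sets prob_lebesgue01 distr_lebesgue01_T[OF a]
    by (auto simp: acip_def absolutely_continuous_def)
qed

lemma AE_lebesgue01_digit_dev_tendsto_0:
  assumes a: "0 < a" "a < 1"
  shows "AE x in lebesgue01. \<forall>u. (\<lambda>n. digit_dev a x u n / n) \<longlonglongrightarrow> 0"
proof -
  have "AE x in lborel. x \<in> {0<..<1} \<longrightarrow> (\<forall>u. (\<lambda>n. digit_dev a x u n / n) \<longlonglongrightarrow> 0)"
    using AE_point_digit_dev_tendsto_0[OF a] by (simp add: AE_completion_iff)
  moreover have "AE x in lborel. x \<noteq> (0::real)" "AE x in lborel. x \<noteq> (1::real)"
    by (rule AE_lborel_singleton)+
  ultimately have "AE x in lborel. x \<in> {0..1} \<longrightarrow> (\<forall>u. (\<lambda>n. digit_dev a x u n / n) \<longlonglongrightarrow> 0)"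
    by eventually_elim auto
  then show ?thesis by (simp add: AE_restrict_space_iff)
qed

text \<open>Continuous ramps converge to the indicator of \<open>{..y}\<close>, so integrals of
  continuous functions determine the distribution function.\<close>

lemma tendsto_integral_cts_step:
  assumes "prob_space M" and sets: "sets M = sets borel01"
  shows "(\<lambda>k. \<integral>x. cts_step y (y + inverse (Suc k)) x \<partial>M) \<longlonglongrightarrow> measure M ({0..1} \<inter> {..y})"
proof -
  interpret prob_space M by fact
  have sp: "space M = {0..1}" using sets_eq_imp_space_eq[OF sets] by (simp add: space_restrict_space)
  have "(\<lambda>k. \<integral>x. cts_step y (y + inverse (Suc k)) x \<partial>M) \<longlonglongrightarrow> (\<integral>x. indicator {..y} x \<partial>M)"
  proof (rule integral_dominated_convergence[where w = "\<lambda>_. 1"])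
    have *: "f \<in> borel_measurable M" if "f \<in> borel_measurable borel" for f :: "real \<Rightarrow> real"
      unfolding measurable_cong_sets[OF sets refl] by (rule measurable_restrict_space1[OF that])
    show "(indicator {..y} :: real \<Rightarrow> real) \<in> borel_measurable M"
      by (rule *) simp
    show "cts_step y (y + inverse (Suc k)) \<in> borel_measurable M" for k
      by (intro * borel_measurable_continuous_onI uniformly_continuous_imp_continuous cts_step_uniformly_continuous) simp
    show "AE x in M. (\<lambda>k. cts_step y (y + inverse (Suc k)) x) \<longlonglongrightarrow> indicator {..y} x"
    proof (rule AE_I2)
      fix x
      show "(\<lambda>k. cts_step y (y + inverse (Suc k)) x) \<longlonglongrightarrow> indicator {..y} x"
      proof (cases "x \<le> y")
        case False
        have "\<forall>\<^sub>F k in sequentially. inverse (real (Suc k)) < x - y"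
          using False by (intro order_tendstoD[OF LIMSEQ_inverse_real_of_nat]) simp
        then have "\<forall>\<^sub>F k in sequentially. 0 = cts_step y (y + inverse (Suc k)) x"
          by eventually_elim (use False in \<open>simp add: cts_step_def\<close>)
        from Lim_transform_eventually[OF tendsto_const this] show ?thesis using False by simp
      qed (simp add: cts_step_def)
    qed
    show "AE x in M. norm (cts_step y (y + inverse (Suc k)) x) \<le> 1" for k
      by (rule AE_I2) (auto simp: cts_step_def divide_le_eq)
  qed simp
  also have "(\<integral>x. indicator {..y} x \<partial>M) = measure M ({0..1} \<inter> {..y})"
    by (simp add: sp Int_commute)
  finally show ?thesis .
qed

lemma acip_unique:
  assumes a: "0 < a" "a < 1" and M: "acip (T a) M"
  shows "M = lebesgue01"
proof -
  have M: "sets M = sets borel01" "prob_space M" "absolutely_continuous lebesgue01 M"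
      "T a \<in> measurable M M" "distr M M (T a) = M"
    using M by (auto simp: acip_def)
  interpret M: prob_space M by fact
  have sp: "space M = {0..1}" using sets_eq_imp_space_eq[OF M(1)] by (simp add: space_restrict_space)
  \<comment> \<open>Absolute continuity transfers the Lebesgue almost everywhere statement to
    \<open>M\<close>.\<close>
  have AE: "AE x in M. \<forall>u. (\<lambda>n. digit_dev a x u n / n) \<longlonglongrightarrow> 0"
    by (rule absolutely_continuous_AE[OF _ M(3) AE_lebesgue01_digit_dev_tendsto_0[OF a]])
      (use M(1) in \<open>simp add: sets_restrict_space\<close>)
  have int: "(\<integral>x. f x \<partial>M) = integral {0..1} f" if f: "continuous_on {0..1} f" for f :: "real \<Rightarrow> real"
  proof -
    have mf: "f \<in> borel_measurable M"
      using borel_measurable_continuous_on_restrict[OF f] measurable_cong_sets[OF M(1) refl] by blast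
    have Ti: "(T a ^^ i) \<in> measurable M M" for i
      by (induction i) (auto intro!: measurable_compose[OF _ M(4)] simp: comp_def)
    have mfi: "(\<lambda>x. f ((T a ^^ i) x)) \<in> borel_measurable M" for i
      by (rule measurable_compose[OF Ti mf])
    obtain B where B: "\<And>x. x \<in> {0..1} \<Longrightarrow> \<bar>f x\<bar> \<le> B"
      using compact_imp_bounded[OF compact_continuous_image[OF f compact_Icc]]
      unfolding bounded_iff real_norm_def by blast
    have orb: "(T a ^^ i) x \<in> {0..1}" if "x \<in> {0..1}" for i x by (rule funpow_T_in_unit[OF a that])
    have inti: "integrable M (\<lambda>x. f ((T a ^^ i) x))" for i
      by (rule M.integrable_const_bound[where B = B, OF _ mfi]) (use B orb sp in \<open>auto intro!: AE_I2\<close>)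
    \<comment> \<open>By invariance every orbit average with \<open>n > 0\<close> has the same
      \<open>M\<close>-integral as \<open>f\<close>, while the averages converge to a
      constant.\<close>
    have inv: "(\<integral>x. f ((T a ^^ i) x) \<partial>M) = (\<integral>x. f x \<partial>M)" for i
    proof (induction i)
      case (Suc i)
      have "(\<integral>x. f ((T a ^^ i) x) \<partial>M) = (\<integral>x. f ((T a ^^ i) x) \<partial>distr M M (T a))" using M(5) by simp
      also have "\<dots> = (\<integral>x. f ((T a ^^ i) (T a x)) \<partial>M)" by (rule integral_distr[OF M(4) mfi])
      finally show ?case using Suc by (simp add: funpow_Suc_right del: funpow.simps)
    qed simp
    have "(\<lambda>n. \<integral>x. (\<Sum>i<n. f ((T a ^^ i) x)) / n \<partial>M) \<longlonglongrightarrow> (\<integral>x. integral {0..1} f \<partial>M)"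
    proof (rule integral_dominated_convergence[where w = "\<lambda>_. B"])
      show "AE x in M. (\<lambda>n. (\<Sum>i<n. f ((T a ^^ i) x)) / n) \<longlonglongrightarrow> integral {0..1} f"
        using AE AE_space
        by eventually_elim (use tendsto_orbit_average[OF a _ f] sp in blast)
      show "AE x in M. norm ((\<Sum>i<n. f ((T a ^^ i) x)) / n) \<le> B" for n
      proof (rule AE_I2)
        fix x assume "x \<in> space M"
        then have x: "x \<in> {0..1}" using sp by simp
        have "B \<ge> 0" using B[of 0] by auto
        moreover have "\<bar>\<Sum>i<n. f ((T a ^^ i) x)\<bar> \<le> (\<Sum>i<n. B)"
          by (rule sum_abs[THEN order.trans], rule sum_mono) (use B orb x in blast)
        ultimately show "norm ((\<Sum>i<n. f ((T a ^^ i) x)) / n) \<le> B"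
          by (cases "n = 0") (auto simp: abs_divide pos_divide_le_eq mult.commute)
      qed
    qed (use mfi in auto)
    moreover have "\<forall>\<^sub>F n in sequentially. (\<integral>x. (\<Sum>i<n. f ((T a ^^ i) x)) / n \<partial>M) = (\<integral>x. f x \<partial>M)"
      using eventually_gt_at_top[of 0]
      by eventually_elim (simp add: Bochner_Integration.integral_sum inti inv)
    ultimately have "(\<lambda>n. \<integral>x. f x \<partial>M) \<longlonglongrightarrow> (\<integral>x. integral {0..1} f \<partial>M)"
      by (rule Lim_transform_eventually)
    then show ?thesis by (simp add: LIMSEQ_const_iff M.prob_space)
  qed
  show ?thesis
  proof (rule measure_borel01_eqI[OF M(2,1) prob_lebesgue01])
    show sets: "sets lebesgue01 = sets borel01" by (simp add: sets_restrict_space)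
    fix y
    have eq: "(\<integral>x. cts_step y (y + inverse (Suc k)) x \<partial>M) = (\<integral>x. cts_step y (y + inverse (Suc k)) x \<partial>lebesgue01)" for k
    proof -
      have "continuous_on {0..1} (cts_step y (y + inverse (Suc k)))"
        by (rule continuous_on_subset[OF uniformly_continuous_imp_continuous[OF cts_step_uniformly_continuous]]) auto
      then show ?thesis by (simp only: int integral_lebesgue01)
    qed
    show "measure M ({0..1} \<inter> {..y}) = measure lebesgue01 ({0..1} \<inter> {..y})"
      using tendsto_integral_cts_step[OF M(2,1), of y] tendsto_integral_cts_step[OF prob_lebesgue01 sets, of y]
      unfolding eq by (rule LIMSEQ_unique)
  qed
qed

theorem proposition1p4:
  fixes X :: "real \<Rightarrow> real"
  assumes "\<And>a. a \<in> {0<..<1} \<Longrightarrow> X a \<in> {0<..<1}"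
    and "X C1_differentiable_on {0<..<1}"
    and "\<And>a. a \<in> {0<..<1} \<Longrightarrow> deriv X a \<le> 0"
  shows "(\<forall>a\<in>{0<..<1}. (\<exists>!M. acip (T a) M) \<and> \<mu> a = lebesgue01) \<and>
    (AE a in lebesgue_on {0<..<1}. typical (T a) (\<mu> a) (X a))"
proof -
  \<comment> \<open>This also resolves the description operator in \<open>\<mu>\<close>.\<close>
  have acip: "acip (T a) M \<longleftrightarrow> M = lebesgue01" if "a \<in> {0<..<1}" for a M
    using that acip_lebesgue01[of a] acip_unique[of a M] by auto
  have mu: "\<mu> a = lebesgue01" if "a \<in> {0<..<1}" for a
    unfolding \<mu>_def acip[OF that] by simp
  have deriv: "(X has_real_derivative deriv X a) (at a)" if "a \<in> {0<..<1}" for a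
    using assms(2) that by (simp add: C1_differentiable_on_eq DERIV_deriv_iff_real_differentiable)
  have anti: "X t \<le> X s" if "0 < s" "s \<le> t" "t < 1" for s t
  proof (rule DERIV_nonpos_imp_nonincreasing[OF that(2)])
    fix x assume "s \<le> x" "x \<le> t"
    then have "x \<in> {0<..<1}" using that by simp
    then show "\<exists>y. (X has_real_derivative y) (at x) \<and> y \<le> 0" using deriv assms(3) by blast
  qed
  have conv: "AE a in lebesgue. a \<in> {0<..<1} \<longrightarrow> (\<forall>u. (\<lambda>n. digit_dev a (X a) u n / n) \<longlonglongrightarrow> 0)"
    by (rule AE_parameter_digit_dev_tendsto_0) (fact assms(1) anti)+
  have "AE a in lebesgue. a \<in> {0<..<1} \<longrightarrow> typical (T a) (\<mu> a) (X a)"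
    using conv
  proof eventually_elim
    case (elim a)
    show ?case
    proof
      assume a: "a \<in> {0<..<1}"
      then show "typical (T a) (\<mu> a) (X a)"
        unfolding mu[OF a] using elim assms(1)[OF a] by (intro typical_lebesgue01) auto
    qed
  qed
  then show ?thesis
    using acip mu by (auto simp: AE_restrict_space_iff)
qed

end
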